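(* Let $0<\epsilon \leq 1/8$. Let $G$ be a $C_4$-free graph of minimum degree at least $d$, and let $T$ be a tree with $|T| \leq \epsilon d^2$ vertices and maximum degree $\Delta(T) \leq d - 2\epsilon d - 2$. Then Algorithm 1 (described in the context) finds an embedding of $T$ in $G$ with high probability, i.e. with probability tending to $1$ as $d \to \infty$ (uniformly over all such $G$ and $T$).
   Context: A graph is $C_4$-free if it contains no cycle of length $4$ as a (not necessarily induced) subgraph. An embedding of a tree $T$ in $G$ is an injective map $f: V(T)\to V(G)$ mapping edges of $T$ to edges of $G$. Algorithm 1: choose a vertex $r$ of $T$ as root (so every other vertex has a parent and children with respect to $r$). Embed $r$ at an arbitrary vertex $f(r)\in V(G)$. As long as $T$ is not completely embedded, take an arbitrary vertex $u\in V(T)$ which is already embedded but whose children are not. If $f(u)$ has enough neighbors in $G$ not occupied by (images of) other vertices of $T$, embed the children of $u$ at distinct vertices chosen uniformly at random from the available (unoccupied) neighbors of $f(u)$, and continue; otherwise the algorithm fails. *)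

theory Defs
  imports "HOL-Probability.Probability" "Graph_Theory.Digraph_Component"
begin

text \<open>
  A finite simple graph is an instance of the library locale \<^locale>\<open>pair_graph\<close>: every edge
  between \<open>u\<close> and \<open>v\<close> is represented by the two arcs \<open>(u, v)\<close> and \<open>(v, u)\<close>, so the degree of a
  vertex is its \<^const>\<open>out_degree\<close>. A library cycle may have length 2, namely \<open>u, v, u\<close>; the
  cycles of the undirected graph are exactly those of length at least 3. (The library constant
  \<^const>\<open>tree\<close> also excludes the cycles of length 2, so it is not the right notion here.)
\<close>

definition is_tree :: "'a pair_pre_digraph \<Rightarrow> bool" where
  "is_tree T \<longleftrightarrow> pair_graph T \<and> Digraph_Component.connected T \<and>
     \<not> (\<exists>p. pre_digraph.cycle T p \<and> 3 \<le> length p)"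

definition C4_free :: "'b pair_pre_digraph \<Rightarrow> bool" where
  "C4_free G \<longleftrightarrow> \<not> (\<exists>p. pre_digraph.cycle G p \<and> length p = 4)"

definition is_embedding :: "'a pair_pre_digraph \<Rightarrow> 'b pair_pre_digraph \<Rightarrow> ('a \<Rightarrow> 'b) \<Rightarrow> bool" where
  "is_embedding T G f \<longleftrightarrow> f ` pverts T \<subseteq> pverts G \<and> inj_on f (pverts T) \<and>
     (\<forall>(x, y) \<in> parcs T. (f x, f y) \<in> parcs G)"

definition neighbours :: "'b pair_pre_digraph \<Rightarrow> 'b \<Rightarrow> 'b set" where
  "neighbours G v = {w. (v, w) \<in> parcs G}"

text \<open>
  \<open>w\<close> is a child of \<open>u\<close> with respect to the root \<open>r\<close> iff \<open>u\<close> is the last vertex before \<open>w\<close> on the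
  path from \<open>r\<close> to \<open>w\<close>.
\<close>

definition children :: "'a pair_pre_digraph \<Rightarrow> 'a \<Rightarrow> 'a \<Rightarrow> 'a set" where
  "children T r u = {w. \<exists>p. pre_digraph.apath T r (p @ [(u, w)]) w}"

text \<open>
  The state of the algorithm is the current partial embedding \<open>f\<close>, so \<open>ran f\<close> is the set of occupied
  vertices of \<open>G\<close>.
\<close>

definition available :: "'b pair_pre_digraph \<Rightarrow> ('a \<rightharpoonup> 'b) \<Rightarrow> 'a \<Rightarrow> 'b set" where
  "available G f u = neighbours G (the (f u)) - ran f"

definition pending :: "'a pair_pre_digraph \<Rightarrow> 'a \<Rightarrow> ('a \<rightharpoonup> 'b) \<Rightarrow> 'a \<Rightarrow> bool" where
  "pending T r f u \<longleftrightarrow> u \<in> dom f \<and> children T r u \<noteq> {} \<and> children T r u \<inter> dom f = {}"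

definition extensions ::
  "'a pair_pre_digraph \<Rightarrow> 'b pair_pre_digraph \<Rightarrow> 'a \<Rightarrow> ('a \<rightharpoonup> 'b) \<Rightarrow> 'a \<Rightarrow> ('a \<rightharpoonup> 'b) set" where
  "extensions T G r f u =
     {f ++ h | h. dom h = children T r u \<and> inj_on h (dom h) \<and> ran h \<subseteq> available G f u}"

text \<open>
  \<open>embed_run T G r f P\<close>: \<open>P\<close> is a possible distribution of the result when the algorithm continues
  from the partial embedding \<open>f\<close>; the result is \<open>None\<close> if the algorithm fails. The arbitrary choices
  of the next vertex \<open>u\<close> are nondeterministic. In the rule \<open>step\<close>, every random outcome \<open>g\<close> gets its
  own continuation \<open>Q g\<close>, so the choices of \<open>u\<close> may depend on the whole history of the run (but not
  on future random choices).
\<close>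

inductive embed_run ::
  "'a pair_pre_digraph \<Rightarrow> 'b pair_pre_digraph \<Rightarrow> 'a \<Rightarrow> ('a \<rightharpoonup> 'b) \<Rightarrow> ('a \<rightharpoonup> 'b) option pmf \<Rightarrow> bool"
  for T G r where
  finished: "dom f = pverts T \<Longrightarrow> embed_run T G r f (return_pmf (Some f))"
| fail: "\<lbrakk>dom f \<noteq> pverts T; pending T r f u;
     card (available G f u) < card (children T r u)\<rbrakk>
   \<Longrightarrow> embed_run T G r f (return_pmf None)"
| step: "\<lbrakk>dom f \<noteq> pverts T; pending T r f u;
     card (children T r u) \<le> card (available G f u);
     \<And>g. g \<in> extensions T G r f u \<Longrightarrow> embed_run T G r g (Q g)\<rbrakk>
   \<Longrightarrow> embed_run T G r f (bind_pmf (pmf_of_set (extensions T G r f u)) Q)"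

definition algorithm1 ::
  "'a pair_pre_digraph \<Rightarrow> 'b pair_pre_digraph \<Rightarrow> 'a \<Rightarrow> 'b \<Rightarrow> ('a \<rightharpoonup> 'b) option pmf \<Rightarrow> bool" where
  "algorithm1 T G r v P \<longleftrightarrow> embed_run T G r [r \<mapsto> v] P"

definition finds_embedding ::
  "'a pair_pre_digraph \<Rightarrow> 'b pair_pre_digraph \<Rightarrow> ('a \<rightharpoonup> 'b) option set" where
  "finds_embedding T G =
     {Some f | f. dom f = pverts T \<and> is_embedding T G (\<lambda>x. the (f x))}"

text \<open>
  Sanity checks: \<^const>\<open>pmf_of_set\<close> is only applied to finite nonempty sets, and the algorithm always
  has at least one output distribution.
\<close>

lemma finite_children:
  assumes "pair_graph T"
  shows "finite (children T r u)"
proof -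
  interpret T: pair_graph T by fact
  have "children T r u \<subseteq> snd ` parcs T"
    by (force simp: children_def T.apath_def T.awalk_def)
  then show ?thesis using T.pair_finite_arcs finite_subset by blast
qed

lemma finite_extensions:
  assumes T: "pair_graph T" and G: "pair_graph G"
  shows "finite (extensions T G r f u)"
proof -
  interpret G: pair_graph G by fact
  have "available G f u \<subseteq> snd ` parcs G"
    by (force simp: available_def neighbours_def)
  then have "finite (available G f u)" using G.pair_finite_arcs finite_subset by blast
  then have "finite {h. dom h = children T r u \<and> ran h \<subseteq> available G f u}"
    by (intro finite_set_of_finite_maps finite_children T)
  then have "finite ((\<lambda>h. f ++ h) ` {h. dom h = children T r u \<and> ran h \<subseteq> available G f u})"
    by simp
  then show ?thesis by (rule rev_finite_subset) (auto simp: extensions_def)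
qed

lemma extensions_nonempty:
  assumes T: "pair_graph T" and G: "pair_graph G"
    and le: "card (children T r u) \<le> card (available G f u)"
  shows "extensions T G r f u \<noteq> {}"
proof -
  interpret G: pair_graph G by fact
  have "available G f u \<subseteq> snd ` parcs G"
    by (force simp: available_def neighbours_def)
  then have "finite (available G f u)" using G.pair_finite_arcs finite_subset by blast
  then obtain k where k: "k ` children T r u \<subseteq> available G f u" "inj_on k (children T r u)"
    using card_le_inj[OF finite_children[OF T] _ le] by blast
  define h where "h x = (if x \<in> children T r u then Some (k x) else None)" for x
  have "dom h = children T r u" "ran h \<subseteq> available G f u" "inj_on h (dom h)"
    using k by (auto simp: h_def dom_def ran_def inj_on_def)
  then show ?thesis unfolding extensions_def by blast
qed

lemma parent_unique:
  assumes T: "is_tree T" and w: "w \<in> children T r u" "w \<in> children T r u'"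
  shows "u = u'"
proof (rule ccontr)
  assume ne: "u \<noteq> u'"
  interpret T: pair_graph T using T by (simp add: is_tree_def)
  from w obtain p q where p: "T.apath r (p @ [(u, w)]) w" and q: "T.apath r (q @ [(u', w)]) w"
    unfolding children_def by blast
  have pw: "T.awalk r p u" "w \<notin> set (T.awalk_verts r p)" "(u, w) \<in> parcs T"
    using p by (auto simp: T.apath_append_iff T.awalk_append_iff T.awalk_Cons_iff T.apath_def
        T.awalk_verts_append T.awalk_Nil_iff)
  have qw: "T.awalk r q u'" "w \<notin> set (T.awalk_verts r q)" "(u', w) \<in> parcs T"
    using q by (auto simp: T.apath_append_iff T.awalk_append_iff T.awalk_Cons_iff T.apath_def
        T.awalk_verts_append T.awalk_Nil_iff)
  have rp: "T.awalk u (rev_path p) r" using pw by simp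
  have walk: "T.awalk u (rev_path p @ q) u'" using rp qw by auto
  have wn: "w \<notin> set (T.awalk_verts u (rev_path p @ q))"
  proof -
    have "T.awalk_verts u (rev_path p @ q) = T.awalk_verts u (rev_path p) @ tl (T.awalk_verts r q)"
      using T.awalk_verts_append[OF walk] rp by auto
    moreover have "T.awalk_verts u (rev_path p) = rev (T.awalk_verts r p)"
      by (rule T.awalk_verts_rev_path[OF pw(1)])
    ultimately show ?thesis using pw(2) qw(2)
      by (metis Un_iff list.set_sel(2) set_append set_rev tl_Nil)
  qed
  define s where "s = T.awalk_to_apath (rev_path p @ q)"
  have s: "T.apath u s u'" using T.apath_awalk_to_apath[OF walk] by (simp add: s_def)
  have sw: "T.awalk u s u'" using s by (simp add: T.apath_def)
  have "set s \<subseteq> set (rev_path p @ q)" using T.awalk_to_apath_subset[OF walk] by (simp add: s_def)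
  then have sub: "set (T.awalk_verts u s) \<subseteq> set (T.awalk_verts u (rev_path p @ q))"
    unfolding T.set_awalk_verts[OF sw] T.set_awalk_verts[OF walk] by auto
  have s_ne: "s \<noteq> []" using s ne by (auto simp: T.apath_Nil_iff)
  have wu: "(w, u) \<in> parcs T" using pw(3) T.arcs_symmetric by blast
  let ?c = "(w, u) # s @ [(u', w)]"
  have "T.awalk w ?c w"
    using wu qw(3) sw by (auto simp: T.awalk_Cons_iff T.awalk_append_iff T.awalk_Nil_iff
        dest: T.in_arcsD1 T.in_arcsD2)
  moreover have "distinct (tl (T.awalk_verts w ?c))"
  proof -
    have "T.awalk u (s @ [(u', w)]) w"
      using sw qw(3) by (auto simp: T.awalk_Cons_iff T.awalk_append_iff T.awalk_Nil_iff
          dest: T.in_arcsD1 T.in_arcsD2)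
    from T.awalk_verts_append[OF this]
    have "T.awalk_verts u (s @ [(u', w)]) = T.awalk_verts u s @ [w]" by simp
    then show ?thesis using s sub wn by (auto simp: T.apath_def)
  qed
  moreover have "3 \<le> length ?c" using s_ne by (cases s) auto
  ultimately show False using T unfolding is_tree_def T.cycle_def by blast
qed

lemma embed_run_exists:
  assumes T: "is_tree T" and r: "r \<in> dom f" and sub: "dom f \<subseteq> pverts T"
    and closed: "\<And>u. children T r u \<subseteq> dom f \<or> children T r u \<inter> dom f = {}"
  shows "\<exists>P. embed_run T G r f P"
  using r sub closed
proof (induction "card (pverts T - dom f)" arbitrary: f rule: less_induct)
  case less
  interpret T: pair_graph T using T by (simp add: is_tree_def)
  show ?case
  proof (cases "dom f = pverts T")
    case True
    then show ?thesis by (blast intro: embed_run.finished)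
  next
    case ne: False
    then obtain w where w: "w \<in> pverts T" "w \<notin> dom f" using less.prems by blast
    have "mk_symmetric T = T"
      using T.arcs_symmetric by (cases T) (auto simp: mk_symmetric_def with_proj_def)
    then have "r \<rightarrow>\<^sup>*\<^bsub>with_proj T\<^esub> w"
      using T w less.prems by (auto simp: is_tree_def connected_def strongly_connected_def)
    then obtain p where p: "T.apath r p w" using T.reachable_apath by blast
    have "\<exists>u. pending T r f u" using p w(2)
    proof (induction p arbitrary: w rule: rev_induct)
      case Nil
      then show ?case using less.prems by (auto simp: T.apath_Nil_iff)
    next
      case (snoc e p)
      obtain u where e: "e = (u, w)" using snoc.prems(1)
        by (cases e) (auto simp: T.apath_append_iff T.apath_def T.awalk_def)
      show ?case
      proof (cases "u \<in> dom f")
        case True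
        have "w \<in> children T r u" using snoc.prems(1) e by (auto simp: children_def)
        then show ?thesis using True snoc.prems(2) less.prems(3)[of u]
          by (auto simp: pending_def)
      next
        case False
        have "T.apath r p u" using snoc.prems(1) e
          by (auto simp: T.apath_append_iff T.apath_def T.awalk_append_iff T.awalk_Cons_iff T.awalk_Nil_iff
              T.awalk_verts_append)
        then show ?thesis using snoc.IH False by blast
      qed
    qed
    then obtain u where u: "pending T r f u" ..
    show ?thesis
    proof (cases "card (available G f u) < card (children T r u)")
      case True
      then show ?thesis using embed_run.fail[OF ne u] by blast
    next
      case False
      have "\<exists>P. embed_run T G r g P" if "g \<in> extensions T G r f u" for g
      proof (rule less.hyps)
        obtain h where "g = f ++ h" "dom h = children T r u"
          using \<open>g \<in> extensions T G r f u\<close> unfolding extensions_def by blast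
        then have dg: "dom g = children T r u \<union> dom f" by simp
        have ch: "children T r u \<subseteq> pverts T"
          by (auto simp: children_def T.apath_def)
        show "dom g \<subseteq> pverts T" "r \<in> dom g" using dg ch less.prems by auto
        show "card (pverts T - dom g) < card (pverts T - dom f)"
        proof (rule psubset_card_mono)
          obtain x where "x \<in> children T r u" "x \<notin> dom f"
            using u unfolding pending_def by blast
          then show "pverts T - dom g \<subset> pverts T - dom f" using dg ch by blast
        qed simp
        show "children T r x \<subseteq> dom g \<or> children T r x \<inter> dom g = {}" for x
          using less.prems(3)[of x] parent_unique[OF T, of _ r x u] dg by (cases "x = u") auto
      qed
      then have "embed_run T G r g (SOME P. embed_run T G r g P)" if "g \<in> extensions T G r f u" for g
        using that someI_ex by fast
      then show ?thesis
        using embed_run.step[OF ne u, of G "\<lambda>g. SOME P. embed_run T G r g P"] False by auto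
    qed
  qed
qed

lemma algorithm1_exists:
  assumes T: "is_tree T" and r: "r \<in> pverts T"
  shows "\<exists>P. algorithm1 T G r v P"
proof -
  interpret T: pair_graph T using T by (simp add: is_tree_def)
  have "r \<notin> children T r u" for u
  proof
    assume "r \<in> children T r u"
    then obtain p where "T.apath r (p @ [(u, r)]) r" by (auto simp: children_def)
    then show False using T.apath_nonempty_ends by fastforce
  qed
  then show ?thesis unfolding algorithm1_def
    by (intro embed_run_exists T) (use r in auto)
qed

end

theory Submission
  imports Defs "HOL-Real_Asymp.Real_Asymp"
begin

text \<open>
  The algorithm can only get stuck at \<open>f u\<close> if more than \<open>2 \<epsilon> d + 2\<close> neighbours of \<open>f u\<close> are
  occupied. Embedding the children of one vertex occupies at most one new neighbour of any other
  vertex \<open>v\<close>, because \<open>G\<close> is \<open>C\<^sub>4\<close>-free, and this happens with probability at most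
  \<open>k / (d - 2 \<epsilon> d - 2)\<close> for \<open>k\<close> children. So the number of occupied neighbours of \<open>v\<close> has
  exponential tails, which are controlled by a supermartingale. To avoid a union bound over the
  unboundedly many vertices of \<open>G\<close>, a vertex only contributes once it has two occupied neighbours;
  as \<open>G\<close> is \<open>C\<^sub>4\<close>-free, there are never more than \<open>|T|\<^sup>2\<close> such vertices.
\<close>

section \<open>Graphs\<close>

lemma neighbours_eq_image: "neighbours G v = snd ` out_arcs (with_proj G) v"
  by (force simp: neighbours_def with_proj_def)

lemma card_neighbours: "card (neighbours G v) = out_degree (with_proj G) v"
proof -
  have "inj_on snd (out_arcs (with_proj G) v)"
    by (auto simp: inj_on_def with_proj_def)
  then show ?thesis by (simp add: neighbours_eq_image out_degree_def card_image)
qed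

lemma finite_neighbours:
  assumes "pair_graph G"
  shows "finite (neighbours G v)"
proof -
  interpret G: pair_graph G by fact
  show ?thesis unfolding neighbours_eq_image by blast
qed

lemma neighbours_sym:
  assumes "pair_graph G"
  shows "w \<in> neighbours G v \<longleftrightarrow> v \<in> neighbours G w"
proof -
  interpret G: pair_graph G by fact
  show ?thesis using G.arcs_symmetric by (auto simp: neighbours_def)
qed

lemma C4_free_common_neighbour_unique:
  assumes G: "pair_graph G" and C4: "C4_free G" and "v \<noteq> v'"
    and x: "x \<in> neighbours G v" "x \<in> neighbours G v'"
    and y: "y \<in> neighbours G v" "y \<in> neighbours G v'"
  shows "x = y"
proof (rule ccontr)
  assume "x \<noteq> y"
  interpret G: pair_graph G by fact
  have arcs: "(v, x) \<in> parcs G" "(x, v') \<in> parcs G" "(v', y) \<in> parcs G" "(y, v) \<in> parcs G"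
    using x y G.arcs_symmetric by (auto simp: neighbours_def)
  then have verts: "v \<in> pverts G" "x \<in> pverts G" "v' \<in> pverts G" "y \<in> pverts G"
    using G.in_arcsD1 by auto
  have ne: "v \<noteq> x" "x \<noteq> v'" "v' \<noteq> y" "y \<noteq> v"
    using arcs G.no_loops' by blast+
  let ?c = "[(v, x), (x, v'), (v', y), (y, v)]"
  have "G.cycle ?c"
    unfolding G.cycle_def using arcs verts ne \<open>v \<noteq> v'\<close> \<open>x \<noteq> y\<close>
    by (intro exI[of _ v]) (auto simp: G.awalk_Cons_iff G.awalk_Nil_iff)
  then show False using C4 by (auto simp: C4_free_def)
qed

section \<open>Parents and children in a rooted tree\<close>

lemma children_subset_neighbours:
  assumes "pair_graph T"
  shows "children T r u \<subseteq> neighbours T u"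
proof -
  interpret T: pair_graph T by fact
  show ?thesis
    by (auto simp: children_def neighbours_def T.apath_def T.awalk_append_iff T.awalk_Cons_iff)
qed

lemma children_subset_pverts:
  assumes "pair_graph T"
  shows "children T r u \<subseteq> pverts T"
proof -
  interpret T: pair_graph T by fact
  show ?thesis by (auto simp: children_def T.apath_def)
qed

lemma root_notin_children:
  assumes "pair_graph T"
  shows "r \<notin> children T r u"
proof
  interpret T: pair_graph T by fact
  assume "r \<in> children T r u"
  then obtain p where "T.apath r (p @ [(u, r)]) r" by (auto simp: children_def)
  then show False using T.apath_nonempty_ends by fastforce
qed

text \<open>Take a path from \<open>r\<close> to \<open>x\<close>. If it avoids \<open>y\<close>,
  appending the arc makes \<open>y\<close> a child of \<open>x\<close>. Otherwise its final piece
  from \<open>y\<close> to \<open>x\<close> closes up with the arc \<open>(x, y)\<close>; in a tree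
  this piece must be the single arc \<open>(y, x)\<close>, so \<open>x\<close> is a child of
  \<open>y\<close>.\<close>

lemma arc_parent_child:
  assumes T: "is_tree T" and r: "r \<in> pverts T" and a: "(x, y) \<in> parcs T"
  shows "y \<in> children T r x \<or> x \<in> children T r y"
proof (rule disjCI)
  assume not: "x \<notin> children T r y"
  interpret T: pair_graph T using T by (simp add: is_tree_def)
  have xy: "x \<in> pverts T" "y \<in> pverts T" using a T.in_arcsD1 T.in_arcsD2 by auto
  \<comment> \<open>\<open>connected\<close> refers to the symmetric closure, which is
    \<open>T\<close> itself because its arcs are already symmetric.\<close>
  have "mk_symmetric T = T"
    using T.arcs_symmetric by (cases T) (auto simp: mk_symmetric_def with_proj_def)
  then have "r \<rightarrow>\<^sup>*\<^bsub>with_proj T\<^esub> x"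
    using T xy r by (auto simp: is_tree_def connected_def strongly_connected_def)
  then obtain p where p: "T.apath r p x" using T.reachable_apath by blast
  then have pw: "T.awalk r p x" by (simp add: T.apath_def)
  have "y \<notin> set (T.awalk_verts r p)"
  proof
    assume "y \<in> set (T.awalk_verts r p)"
    then obtain p1 p2 where p12: "p = p1 @ p2" "T.awalk r p1 y" "T.awalk y p2 x"
      using T.awalk_decomp[OF pw] by blast
    then have p2: "T.apath y p2 x" using p T.apath_append_iff by auto
    have "x \<noteq> y" using a T.no_loops' by blast
    show False
    proof (cases "length p2 \<ge> 2")
      case True
      let ?c = "(x, y) # p2"
      have "T.cycle ?c"
        unfolding T.cycle_def using a xy p2
        by (intro exI[of _ x]) (auto simp: T.awalk_Cons_iff T.apath_def)
      moreover have "length ?c \<ge> 3" using True by simp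
      ultimately show False using T unfolding is_tree_def by blast
    next
      case False
      then consider "p2 = []" | e where "p2 = [e]"
        by (cases p2; cases "tl p2") auto
      then show False
      proof cases
        case 1
        then show False using p12(3) \<open>x \<noteq> y\<close> by (simp add: T.awalk_Nil_iff)
      next
        case 2
        then have "p2 = [(y, x)]" using p12(3)
          by (cases e) (auto simp: T.awalk_Cons_iff T.awalk_Nil_iff)
        then show False using not p p12(1) by (auto simp: children_def)
      qed
    qed
  qed
  then have "T.apath r (p @ [(x, y)]) y"
    using p a xy
    by (auto simp: T.apath_append_iff T.apath_def T.awalk_append_iff T.awalk_Cons_iff T.awalk_Nil_iff
        T.awalk_verts_append)
  then show "y \<in> children T r x" by (auto simp: children_def)
qed

section \<open>Random injections\<close>

text \<open>The random part of one step, detached from the graphs so that the symmetry among the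
  points of \<open>A\<close> can be exploited.\<close>

definition inj_maps :: "'a set \<Rightarrow> 'b set \<Rightarrow> ('a \<rightharpoonup> 'b) set" where
  "inj_maps C A = {h. dom h = C \<and> inj_on h (dom h) \<and> ran h \<subseteq> A}"

lemma finite_inj_maps:
  assumes "finite C" "finite A"
  shows "finite (inj_maps C A)"
  using finite_set_of_finite_maps[OF assms] by (rule rev_finite_subset) (auto simp: inj_maps_def)

lemma card_ran_inj:
  assumes "inj_on h (dom h)"
  shows "card (ran h) = card (dom h)"
proof -
  have "ran h = (\<lambda>x. the (h x)) ` dom h" by (force simp: ran_def dom_def)
  moreover have "inj_on (\<lambda>x. the (h x)) (dom h)"
    using assms by (auto simp: inj_on_def dom_def)
  ultimately show ?thesis by (simp add: card_image)
qed

text \<open>Composing with the transposition of \<open>w\<close> and \<open>w'\<close>, which maps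
  \<open>A\<close> to itself, injects the maps hitting \<open>w\<close> into those hitting
  \<open>w'\<close>.\<close>

lemma card_inj_maps_hit_le:
  assumes "finite C" "finite A" "w \<in> A" "w' \<in> A"
  shows "card {h \<in> inj_maps C A. w \<in> ran h} \<le> card {h \<in> inj_maps C A. w' \<in> ran h}"
proof (rule card_inj_on_le)
  let ?t = "Transposition.transpose w w'"
  let ?F = "\<lambda>h. map_option ?t \<circ> h"
  have inj_t: "inj (map_option ?t)" by (intro option.inj_map) simp
  then show "inj_on ?F {h \<in> inj_maps C A. w \<in> ran h}"
    by (auto simp: inj_on_def fun_eq_iff inj_def)
  have ran: "ran (?F h) = ?t ` ran h" for h :: "'a \<rightharpoonup> 'b"
    by (auto simp: ran_def)
  have dom: "dom (?F h) = dom h" for h :: "'a \<rightharpoonup> 'b"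
    by (auto simp: dom_def)
  have inj: "inj_on (?F h) X" if "inj_on h X" for h :: "'a \<rightharpoonup> 'b" and X
    using that inj_t by (intro comp_inj_on) (auto intro: inj_on_subset)
  have A: "?t ` A = A" using assms(3,4) by (auto simp: Transposition.transpose_def image_iff)
  have "?t w = w'" by simp
  then show "?F ` {h \<in> inj_maps C A. w \<in> ran h} \<subseteq> {h \<in> inj_maps C A. w' \<in> ran h}"
    using A by (auto simp: inj_maps_def ran dom intro!: inj simp del: transpose_apply_first; force)
  show "finite {h \<in> inj_maps C A. w' \<in> ran h}" using finite_inj_maps[OF assms(1,2)] by simp
qed

text \<open>Double counting of pairs of a map and a point in its range: by symmetry every point of
  \<open>A\<close> is hit equally often, and every map hits \<open>card C\<close> points. So a fixed
  point is hit with probability \<open>card C / card A\<close>.\<close>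

lemma card_inj_maps_hit:
  assumes fin: "finite C" "finite A" and w: "w \<in> A"
  shows "card A * card {h \<in> inj_maps C A. w \<in> ran h} = card C * card (inj_maps C A)"
proof -
  let ?H = "inj_maps C A"
  have eq: "card {h \<in> ?H. w' \<in> ran h} = card {h \<in> ?H. w \<in> ran h}" if "w' \<in> A" for w'
    using card_inj_maps_hit_le[OF fin] w that by (intro order_antisym) auto
  have "card A * card {h \<in> ?H. w \<in> ran h} = (\<Sum>w'\<in>A. card {h \<in> ?H. w' \<in> ran h})"
    by (simp add: eq)
  also have "\<dots> = (\<Sum>w'\<in>A. \<Sum>h\<in>?H. if w' \<in> ran h then 1 else 0)"
    using finite_inj_maps[OF fin] by (simp add: sum.If_cases Int_def)
  also have "\<dots> = (\<Sum>h\<in>?H. \<Sum>w'\<in>A. if w' \<in> ran h then 1 else 0)"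
    by (rule sum.swap)
  also have "\<dots> = (\<Sum>h\<in>?H. card C)"
  proof (rule sum.cong[OF refl])
    fix h assume h: "h \<in> ?H"
    then have "A \<inter> ran h = ran h" "card (ran h) = card C"
      using card_ran_inj[of h] by (auto simp: inj_maps_def)
    then show "(\<Sum>w'\<in>A. if w' \<in> ran h then 1 else 0) = card C"
      using fin by (simp add: sum.If_cases)
  qed
  finally show ?thesis by simp
qed

section \<open>The uniform distribution on the extensions of a partial embedding\<close>

lemma extensions_eq_image:
  "extensions T G r f u = (\<lambda>h. f ++ h) ` inj_maps (children T r u) (available G f u)"
  by (auto simp: extensions_def inj_maps_def)

lemma finite_available: "pair_graph G \<Longrightarrow> finite (available G f u)"
  by (simp add: available_def finite_neighbours)

lemma extensionsE:
  assumes "pending T r f u" "g \<in> extensions T G r f u"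
  obtains h where "g = f ++ h" "dom h = children T r u" "inj_on h (dom h)"
    "ran h \<subseteq> available G f u" "ran g = ran f \<union> ran h" "dom f \<inter> dom h = {}"
proof -
  obtain h where h: "g = f ++ h" "dom h = children T r u" "inj_on h (dom h)"
    "ran h \<subseteq> available G f u"
    using assms by (auto simp: extensions_def)
  moreover have "dom f \<inter> dom h = {}" using assms h by (auto simp: pending_def)
  ultimately show ?thesis using that ran_map_add by blast
qed

text \<open>The count for random injections carries over because \<open>f ++ h\<close> determines
  \<open>h\<close>, whose domain is fixed, and because an available \<open>w\<close> is not yet in
  \<open>ran f\<close>, so only \<open>h\<close> can hit it.\<close>

lemma card_extensions_hit:
  assumes T: "pair_graph T" and G: "pair_graph G" and pend: "pending T r f u"
    and w: "w \<in> available G f u"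
  shows "card (available G f u) * card {g \<in> extensions T G r f u. w \<in> ran g} =
    card (children T r u) * card (extensions T G r f u)"
proof -
  let ?H = "inj_maps (children T r u) (available G f u)"
  have disj: "dom f \<inter> dom h = {}" if "h \<in> ?H" for h
    using that pend by (auto simp: inj_maps_def pending_def)
  have inj: "inj_on (\<lambda>h. f ++ h) ?H"
  proof (rule inj_onI)
    fix h h' assume hh: "h \<in> ?H" "h' \<in> ?H" "f ++ h = f ++ h'"
    show "h = h'"
    proof
      fix x
      show "h x = h' x"
      proof (cases "x \<in> children T r u")
        case True
        then have "x \<in> dom h" "x \<in> dom h'" using hh by (auto simp: inj_maps_def)
        then show ?thesis using fun_cong[OF hh(3), of x] by (auto simp: map_add_dom_app_simps)
      next
        case False
        then have "x \<notin> dom h" "x \<notin> dom h'" using hh by (auto simp: inj_maps_def)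
        then show ?thesis by (simp add: domIff)
      qed
    qed
  qed
  have "w \<in> ran (f ++ h) \<longleftrightarrow> w \<in> ran h" if "h \<in> ?H" for h
    using w ran_map_add[OF disj[OF that]] by (auto simp: available_def)
  then have "{g \<in> extensions T G r f u. w \<in> ran g} = (\<lambda>h. f ++ h) ` {h \<in> ?H. w \<in> ran h}"
    by (auto simp: extensions_eq_image)
  then have "card {g \<in> extensions T G r f u. w \<in> ran g} = card {h \<in> ?H. w \<in> ran h}"
    using inj by (metis (no_types, lifting) card_image inj_on_subset mem_Collect_eq subsetI)
  moreover have "card (extensions T G r f u) = card ?H"
    using inj by (simp add: extensions_eq_image card_image)
  ultimately show ?thesis
    using card_inj_maps_hit[OF finite_children[OF T] finite_available[OF G] w] by simp
qed

section \<open>Partial embeddings\<close>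

text \<open>The invariant of a run. Adjacency is only demanded between parent and child, which by
  \<open>arc_parent_child\<close> covers all arcs of the tree in the end.\<close>

definition partial_embedding ::
  "'a pair_pre_digraph \<Rightarrow> 'b pair_pre_digraph \<Rightarrow> 'a \<Rightarrow> ('a \<rightharpoonup> 'b) \<Rightarrow> bool" where
  "partial_embedding T G r f \<longleftrightarrow> dom f \<subseteq> pverts T \<and> ran f \<subseteq> pverts G \<and> inj_on f (dom f) \<and>
     (\<forall>x y. y \<in> children T r x \<longrightarrow> y \<in> dom f \<longrightarrow>
        x \<in> dom f \<and> the (f y) \<in> neighbours G (the (f x)))"

lemma partial_embedding_root:
  assumes "pair_graph T" "r \<in> pverts T" "v \<in> pverts G"
  shows "partial_embedding T G r [r \<mapsto> v]"
  using assms root_notin_children[OF assms(1)]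
  by (auto simp: partial_embedding_def)

text \<open>Injectivity survives because the new images avoid \<open>ran f\<close>. Adjacency
  survives because a newly embedded vertex has \<open>u\<close> as its only parent, by
  \<open>parent_unique\<close>.\<close>

lemma partial_embedding_step:
  assumes T: "is_tree T" and G: "pair_graph G" and f: "partial_embedding T G r f"
    and pend: "pending T r f u" and g: "g \<in> extensions T G r f u"
  shows "partial_embedding T G r g"
proof -
  interpret G: pair_graph G by fact
  have pT: "pair_graph T" using T by (simp add: is_tree_def)
  obtain h where h: "g = f ++ h" "dom h = children T r u" "inj_on h (dom h)"
    "ran h \<subseteq> available G f u" "ran g = ran f \<union> ran h" "dom f \<inter> dom h = {}"
    using extensionsE[OF pend g] .
  have u: "u \<in> dom f" using pend by (simp add: pending_def)
  have gf: "g x = f x" if "x \<in> dom f" for x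
  proof -
    have "x \<notin> dom h" using that h(6) by blast
    then show ?thesis by (simp add: h(1) map_add_dom_app_simps)
  qed
  have gh: "g x = h x" if "x \<in> children T r u" for x
    using that by (simp add: h(1,2) map_add_dom_app_simps)
  have dg: "dom g = dom f \<union> children T r u" using h by auto
  have "dom g \<subseteq> pverts T"
    using dg f children_subset_pverts[OF pT] by (auto simp: partial_embedding_def)
  moreover have "neighbours G x \<subseteq> pverts G" for x
    using G.in_arcsD2 by (auto simp: neighbours_def)
  then have "ran g \<subseteq> pverts G"
    using f h(4,5) unfolding partial_embedding_def available_def by blast
  moreover have "inj_on g (dom g)"
  proof -
    have "inj_on g (dom f)" using f gf by (simp add: partial_embedding_def inj_on_def)
    moreover have "inj_on g (children T r u)" using h(2,3) gh by (simp add: inj_on_def)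
    moreover have "g x \<noteq> g y" if xy: "x \<in> dom f" "y \<in> children T r u" for x y
    proof
      assume "g x = g y"
      then have eq: "f x = h y" using gf gh xy by simp
      obtain z where z: "h y = Some z" using xy(2) h(2) by blast
      then have "z \<in> ran f" "z \<in> ran h" using eq by (auto intro: ranI)
      then show False using h(4) by (auto simp: available_def)
    qed
    ultimately show ?thesis unfolding dg inj_on_def by (metis Un_iff)
  qed
  moreover have "x \<in> dom g \<and> the (g y) \<in> neighbours G (the (g x))"
    if y: "y \<in> children T r x" "y \<in> dom g" for x y
  proof (cases "y \<in> dom f")
    case True
    then show ?thesis using y f gf dg by (auto simp: partial_embedding_def)
  next
    case False
    then have yu: "y \<in> children T r u" using y dg by auto
    then have "x = u" using parent_unique[OF T] y by blast
    obtain z where z: "h y = Some z" using yu h(2) by blast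
    then have "z \<in> available G f u" using h(4) ranI by fast
    then have "the (g y) \<in> neighbours G (the (f u))" using z gh[OF yu] by (simp add: available_def)
    then show ?thesis using \<open>x = u\<close> u dg gf[OF u] by simp
  qed
  ultimately show ?thesis by (simp add: partial_embedding_def)
qed

lemma partial_embedding_finished:
  assumes T: "is_tree T" and G: "pair_graph G" and r: "r \<in> pverts T"
    and f: "partial_embedding T G r f" and dom: "dom f = pverts T"
  shows "Some f \<in> finds_embedding T G"
proof -
  interpret G: pair_graph G by fact
  interpret T: pair_graph T using T by (simp add: is_tree_def)
  let ?f = "\<lambda>x. the (f x)"
  have "?f ` pverts T \<subseteq> ran f" using dom by (force simp: ran_def)
  then have "?f ` pverts T \<subseteq> pverts G" using f by (auto simp: partial_embedding_def)
  moreover have "inj_on ?f (pverts T)"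
  proof (rule inj_onI)
    fix x y assume xy: "x \<in> pverts T" "y \<in> pverts T" "?f x = ?f y"
    then have "f x \<noteq> None" "f y \<noteq> None" using dom by auto
    then have "f x = f y" using xy(3) by (intro option.expand) auto
    then show "x = y" using xy f dom by (auto simp: partial_embedding_def inj_on_def)
  qed
  moreover have "(?f x, ?f y) \<in> parcs G" if "(x, y) \<in> parcs T" for x y
  proof -
    have "x \<in> dom f" "y \<in> dom f" using that dom T.in_arcsD1 T.in_arcsD2 by auto
    then have "?f y \<in> neighbours G (?f x) \<or> ?f x \<in> neighbours G (?f y)"
      using arc_parent_child[OF T r that] f unfolding partial_embedding_def by blast
    then show ?thesis using neighbours_sym[OF G] by (auto simp: neighbours_def)
  qed
  ultimately show ?thesis using dom by (auto simp: finds_embedding_def is_embedding_def)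
qed

section \<open>The potential function\<close>

definition occupied :: "'b pair_pre_digraph \<Rightarrow> ('a \<rightharpoonup> 'b) \<Rightarrow> 'b \<Rightarrow> nat" where
  "occupied G f v = card (neighbours G v \<inter> ran f)"

definition active :: "'a pair_pre_digraph \<Rightarrow> 'a \<Rightarrow> ('a \<rightharpoonup> 'b) \<Rightarrow> 'b set" where
  "active T r f = {v. \<forall>u. f u = Some v \<longrightarrow> children T r u \<inter> dom f = {}}"

text \<open>
  The images of the vertices whose children are already embedded need no control any more; dropping
  them is necessary, since the number of their occupied neighbours jumps when they are processed.
\<close>

definition weight ::
  "real \<Rightarrow> 'a pair_pre_digraph \<Rightarrow> 'b pair_pre_digraph \<Rightarrow> 'a \<Rightarrow> ('a \<rightharpoonup> 'b) \<Rightarrow> 'b \<Rightarrow> real" where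
  "weight L T G r f v =
     (if v \<in> active T r f then L ^ max 2 (occupied G f v) - L ^ 2 else 0)"

text \<open>The additive constant makes the growth multiplicative: a hit on a vertex with at least
  two occupied neighbours costs \<open>L - 1\<close> times its weight plus \<open>L ^ 2\<close>, and
  the terms \<open>L ^ 2\<close> of all such vertices together are at most this constant.\<close>

definition total_weight ::
  "real \<Rightarrow> 'a pair_pre_digraph \<Rightarrow> 'b pair_pre_digraph \<Rightarrow> 'a \<Rightarrow> ('a \<rightharpoonup> 'b) \<Rightarrow> real" where
  "total_weight L T G r f =
     (\<Sum>v\<in>pverts G. weight L T G r f v) + L ^ 2 * real (card (pverts T)) ^ 2"

lemma weight_nonneg: "1 \<le> L \<Longrightarrow> 0 \<le> weight L T G r f v"
  by (simp add: weight_def power_increasing)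

lemma total_weight_nonneg: "1 \<le> L \<Longrightarrow> 0 \<le> total_weight L T G r f"
  by (simp add: total_weight_def sum_nonneg weight_nonneg)

text \<open>Choose for each such vertex an ordered pair of distinct occupied neighbours. Two
  vertices with the same pair would have two common neighbours, so the choice is injective. The
  bound does not depend on the size of \<open>G\<close>.\<close>

lemma card_crowded_le:
  assumes G: "pair_graph G" "C4_free G" and fin: "finite (ran f)"
  shows "card {v \<in> pverts G. 2 \<le> occupied G f v} \<le> card (ran f) ^ 2"
proof -
  let ?W = "{v \<in> pverts G. 2 \<le> occupied G f v}"
  have "\<exists>p. fst p \<noteq> snd p \<and> fst p \<in> neighbours G v \<inter> ran f \<and> snd p \<in> neighbours G v \<inter> ran f"
    if "v \<in> ?W" for v
  proof -
    have "2 \<le> card (neighbours G v \<inter> ran f)" using that by (simp add: occupied_def)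
    then obtain S where "S \<subseteq> neighbours G v \<inter> ran f" "card S = 2"
      using obtain_subset_with_card_n by metis
    then show ?thesis by (auto simp: card_2_iff)
  qed
  then obtain p where p: "fst (p v) \<noteq> snd (p v) \<and> fst (p v) \<in> neighbours G v \<inter> ran f \<and>
      snd (p v) \<in> neighbours G v \<inter> ran f" if "v \<in> ?W" for v
    by metis
  have "inj_on p ?W"
  proof (rule inj_onI, rule ccontr)
    fix v v' assume "v \<in> ?W" "v' \<in> ?W" "p v = p v'" "v \<noteq> v'"
    then show False
      using p[of v] p[of v'] C4_free_common_neighbour_unique[OF G, of v v' "fst (p v)" "snd (p v)"]
      by auto
  qed
  moreover have "p ` ?W \<subseteq> ran f \<times> ran f"
  proof
    fix x assume "x \<in> p ` ?W"
    then obtain v where "v \<in> ?W" "x = p v" by blast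
    then show "x \<in> ran f \<times> ran f" using p[of v] by (auto simp: mem_Times_iff)
  qed
  ultimately have "card ?W \<le> card (ran f \<times> ran f)"
    using fin by (intro card_inj_on_le[of p]) auto
  then show ?thesis by (simp add: card_cartesian_product power2_eq_square)
qed

section \<open>Expected change of the potential in one step\<close>

lemma active_step:
  assumes pend: "pending T r f u" and g: "g \<in> extensions T G r f u"
  shows "active T r g \<subseteq> active T r f - {the (f u)}"
proof
  fix v assume v: "v \<in> active T r g"
  obtain h where h: "g = f ++ h" "dom h = children T r u" "dom f \<inter> dom h = {}"
    using extensionsE[OF pend g] by metis
  have gf: "g x = f x" if "x \<in> dom f" for x
  proof -
    have "x \<notin> dom h" using that h(3) by blast
    then show ?thesis by (simp add: h(1) map_add_dom_app_simps)
  qed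
  have dg: "dom g = dom f \<union> children T r u" using h by auto
  have *: "children T r x \<inter> (dom f \<union> children T r u) = {}" if "f x = Some v" for x
  proof -
    have "g x = Some v" using gf[of x] that by (simp add: domIff)
    then show ?thesis using v dg by (auto simp: active_def)
  qed
  \<comment> \<open>\<open>u\<close> has children, and all of them are embedded by \<open>g\<close>,
    so its image stops being active.\<close>
  have "v \<noteq> the (f u)"
  proof
    assume "v = the (f u)"
    then have "f u = Some v" using pend by (auto simp: pending_def)
    then show False using *[of u] pend by (auto simp: pending_def)
  qed
  then show "v \<in> active T r f - {the (f u)}" using * by (auto simp: active_def)
qed

text \<open>At most one available vertex is adjacent to both \<open>v\<close> and
  \<open>f u\<close>, so the number of occupied neighbours of \<open>v\<close> grows by at most one,
  with probability at most the number of children divided by the number of available vertices. From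
  two occupied neighbours on, such a hit multiplies the power of \<open>L\<close> by
  \<open>L\<close>; below two it costs nothing because of the cutoff. The statement is an
  expectation multiplied by the number of outcomes.\<close>

lemma weight_step:
  assumes T: "pair_graph T" and G: "pair_graph G" "C4_free G" and L: "1 \<le> L"
    and pend: "pending T r f u" and fin: "finite (ran f)"
    and avail: "0 < card (available G f u)"
  shows "(\<Sum>g\<in>extensions T G r f u. weight L T G r g v) \<le>
    real (card (extensions T G r f u)) *
    (weight L T G r f v +
     (L - 1) * real (card (children T r u)) / real (card (available G f u)) *
     (if 2 \<le> occupied G f v then weight L T G r f v + L ^ 2 else 0))"
    (is "?lhs \<le> real (card ?S) * (?wf + ?q * ?e)")
proof -
  have q: "0 \<le> ?q" "0 \<le> ?e" "0 \<le> ?wf" using L weight_nonneg[OF L, of T G r f v] by auto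
  show ?thesis
  proof (cases "v \<in> active T r f - {the (f u)}")
    \<comment> \<open>Inactive vertices stay inactive and \<open>f u\<close> becomes inactive, so
      the weight after the step is zero.\<close>
    case False
    have "weight L T G r g v = 0" if "g \<in> ?S" for g
      using active_step[OF pend that] False by (auto simp: weight_def)
    then have "?lhs = 0" by simp
    also have "0 \<le> real (card ?S) * (?wf + ?q * ?e)"
      using q by (intro mult_nonneg_nonneg add_nonneg_nonneg) auto
    finally show ?thesis .
  next
    case True
    let ?K = "neighbours G v \<inter> available G f u"
    define hit where "hit = {g \<in> ?S. ?K \<inter> ran g \<noteq> {}}"
    define e where "e = ?e"
    have unique: "x = y" if "x \<in> ?K" "y \<in> ?K" for x y
      using C4_free_common_neighbour_unique[OF G, of v "the (f u)" x y] that True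
      by (auto simp: available_def)
    have finS: "finite ?S" by (rule finite_extensions[OF T G(1)])
    have step: "weight L T G r g v \<le> ?wf + (if g \<in> hit then (L - 1) * e else 0)"
      if g: "g \<in> ?S" for g
    proof -
      have h: "ran g - ran f \<subseteq> available G f u"
        using extensionsE[OF pend g] by (metis Diff_subset_conv Un_mono order_refl)
      have finK: "finite ?K" by (intro finite_Int disjI2 finite_available G)
      have "neighbours G v \<inter> ran g \<subseteq> (neighbours G v \<inter> ran f) \<union> (?K \<inter> ran g)"
        using h by auto
      then have "occupied G g v \<le> card ((neighbours G v \<inter> ran f) \<union> (?K \<inter> ran g))"
        unfolding occupied_def using fin finK by (intro card_mono) auto
      also have "\<dots> \<le> occupied G f v + card (?K \<inter> ran g)"
        unfolding occupied_def by (rule card_Un_le)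
      finally have occ: "occupied G g v \<le> occupied G f v + card (?K \<inter> ran g)" .
      have K1: "card (?K \<inter> ran g) \<le> 1"
        using unique finK by (auto simp: card_le_Suc0_iff_eq)
      show ?thesis
      proof (cases "v \<in> active T r g")
        case False
        then have "weight L T G r g v = 0" by (simp add: weight_def)
        moreover have "0 \<le> (L - 1) * e" using L q(2) unfolding e_def by (intro mult_nonneg_nonneg) auto
        ultimately show ?thesis using q(3) by (auto simp only: split: if_splits)
      next
        case act: True
        show ?thesis
        proof (cases "2 \<le> occupied G f v")
          case False
          \<comment> \<open>One occupied neighbour may become two, which is still at the cutoff, so
            the weight remains zero.\<close>
          then have "max 2 (occupied G g v) = 2" using occ K1 by linarith
          then show ?thesis using False q act by (simp add: weight_def e_def)
        next
          case two: True
          have e: "e = L ^ occupied G f v" "?wf = L ^ occupied G f v - L ^ 2"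
            using two True by (auto simp: weight_def max_def e_def)
          have wg: "weight L T G r g v = L ^ max 2 (occupied G g v) - L ^ 2"
            using act by (simp add: weight_def)
          show ?thesis
          proof (cases "g \<in> hit")
            case True
            have "max 2 (occupied G g v) \<le> Suc (occupied G f v)" using occ K1 two by linarith
            then have "L ^ max 2 (occupied G g v) \<le> L ^ Suc (occupied G f v)"
              using L by (rule power_increasing)
            then show ?thesis unfolding wg if_P[OF True] e(1) unfolding e(2)
              by (simp add: algebra_simps)
          next
            case False
            then have "?K \<inter> ran g = {}" using g by (auto simp: hit_def)
            then have "max 2 (occupied G g v) \<le> occupied G f v" using occ two by simp
            then have "L ^ max 2 (occupied G g v) \<le> L ^ occupied G f v"
              using L by (rule power_increasing)
            then show ?thesis unfolding wg if_not_P[OF False] e(2) by simp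
          qed
        qed
      qed
    qed
    have card_hit: "real (card hit) \<le> real (card (children T r u)) * real (card ?S) / real (card (available G f u))"
    proof (cases "?K = {}")
      case True
      then show ?thesis by (simp add: hit_def)
    next
      case False
      \<comment> \<open>The only way to gain an occupied neighbour is to hit the unique common
        neighbour \<open>w\<close>, whose hitting probability is known exactly.\<close>
      then obtain w where w: "?K = {w}" using unique by blast
      then have hw: "hit = {g \<in> ?S. w \<in> ran g}" by (auto simp: hit_def)
      have "w \<in> available G f u" using w by blast
      from card_extensions_hit[OF T G(1) pend this]
      have "card (available G f u) * card hit = card (children T r u) * card ?S"
        unfolding hw .
      then have "real (card (available G f u)) * real (card hit) =
          real (card (children T r u)) * real (card ?S)"
        by (metis of_nat_mult)
      then show ?thesis using avail by (simp add: field_simps)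
    qed
    have "?lhs \<le> (\<Sum>g\<in>?S. ?wf + (if g \<in> hit then (L - 1) * e else 0))"
      by (intro sum_mono step)
    also have "\<dots> = real (card ?S) * ?wf + real (card hit) * ((L - 1) * e)"
    proof -
      have "?S \<inter> {g. g \<in> hit} = hit" by (auto simp: hit_def)
      then show ?thesis using finS by (simp only: sum.distrib sum.If_cases) simp
    qed
    also have "\<dots> \<le> real (card ?S) * ?wf +
        real (card (children T r u)) * real (card ?S) / real (card (available G f u)) * ((L - 1) * e)"
      using L q(2) card_hit unfolding e_def
      by (intro add_left_mono mult_right_mono mult_nonneg_nonneg) auto
    also have "\<dots> = real (card ?S) * (?wf + ?q * e)" by (simp add: algebra_simps)
    finally show ?thesis unfolding e_def .
  qed
qed

text \<open>Summing \<open>weight_step\<close> over all vertices, the possible increments add up to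
  at most \<open>total_weight\<close> itself, since at most \<open>card (pverts T) ^ 2\<close>
  vertices have two occupied neighbours. Hence the expected growth factor is at most
  \<open>1 + ?q\<close>.\<close>

lemma total_weight_step:
  assumes T: "is_tree T" and G: "pair_graph G" "C4_free G" and L: "1 \<le> L"
    and f: "partial_embedding T G r f"
    and pend: "pending T r f u" and avail: "0 < card (available G f u)"
  shows "(\<Sum>g\<in>extensions T G r f u. total_weight L T G r g) \<le>
    real (card (extensions T G r f u)) *
    ((1 + (L - 1) * real (card (children T r u)) / real (card (available G f u))) *
     total_weight L T G r f)"
    (is "_ \<le> real (card ?S) * ((1 + ?q) * _)")
proof -
  interpret G: pair_graph G by fact
  interpret T: pair_graph T using T by (simp add: is_tree_def)
  let ?N = "L ^ 2 * real (card (pverts T)) ^ 2"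
  let ?w = "\<lambda>v. weight L T G r f v"
  have fdom: "finite (dom f)" "dom f \<subseteq> pverts T"
    using f finite_subset[OF _ T.pair_finite_verts] by (auto simp: partial_embedding_def)
  have ran: "card (ran f) \<le> card (pverts T)"
    using f fdom card_mono[OF T.pair_finite_verts fdom(2)]
    by (simp add: card_ran_inj partial_embedding_def)
  have "card {v \<in> pverts G. 2 \<le> occupied G f v} \<le> card (ran f) ^ 2"
    using card_crowded_le[OF G] fdom finite_ran by blast
  also have "\<dots> \<le> card (pverts T) ^ 2" using ran by (rule power_mono) simp
  finally have W: "real (card {v \<in> pverts G. 2 \<le> occupied G f v}) \<le> real (card (pverts T)) ^ 2"
    by (metis of_nat_le_iff of_nat_power)
  have "(\<Sum>v\<in>pverts G. if 2 \<le> occupied G f v then ?w v + L ^ 2 else 0) =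
      (\<Sum>v | v \<in> pverts G \<and> 2 \<le> occupied G f v. ?w v + L ^ 2)"
    using G.pair_finite_verts by (simp add: sum.inter_filter)
  also have "\<dots> = (\<Sum>v | v \<in> pverts G \<and> 2 \<le> occupied G f v. ?w v) +
      L ^ 2 * real (card {v \<in> pverts G. 2 \<le> occupied G f v})"
    by (simp add: sum.distrib)
  also have "\<dots> \<le> (\<Sum>v\<in>pverts G. ?w v) + ?N"
    using G.pair_finite_verts W L
    by (intro add_mono sum_mono2 mult_left_mono) (auto simp: weight_nonneg)
  finally have crowd: "(\<Sum>v\<in>pverts G. if 2 \<le> occupied G f v then ?w v + L ^ 2 else 0) \<le>
      total_weight L T G r f" by (simp add: total_weight_def)
  have q: "0 \<le> ?q" using L by simp
  have "(\<Sum>g\<in>?S. total_weight L T G r g) =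
      (\<Sum>v\<in>pverts G. \<Sum>g\<in>?S. weight L T G r g v) + real (card ?S) * ?N"
    by (simp add: total_weight_def sum.distrib sum.swap[of _ "pverts G"])
  also have "\<dots> \<le> (\<Sum>v\<in>pverts G. real (card ?S) *
      (?w v + ?q * (if 2 \<le> occupied G f v then ?w v + L ^ 2 else 0))) + real (card ?S) * ?N"
    using fdom(1) finite_ran
    by (intro add_right_mono sum_mono weight_step T.pair_graph G L pend avail) auto
  also have "\<dots> = real (card ?S) * (total_weight L T G r f +
      ?q * (\<Sum>v\<in>pverts G. if 2 \<le> occupied G f v then ?w v + L ^ 2 else 0))"
    unfolding total_weight_def sum_distrib_left[symmetric] sum.distrib
    by (simp only: distrib_left)
  also have "\<dots> \<le> real (card ?S) * (total_weight L T G r f + ?q * total_weight L T G r f)"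
    using crowd q by (intro mult_left_mono add_left_mono) auto
  also have "\<dots> = real (card ?S) * ((1 + ?q) * total_weight L T G r f)"
    by (simp add: algebra_simps)
  finally show ?thesis .
qed

section \<open>The failure probability\<close>

lemma prob_bind_pmf_of_set:
  assumes "finite S" "S \<noteq> {}"
  shows "measure_pmf.prob (bind_pmf (pmf_of_set S) Q) X = (\<Sum>x\<in>S. measure_pmf.prob (Q x) X) / card S"
proof -
  have "ennreal (measure_pmf.prob (bind_pmf (pmf_of_set S) Q) X) =
      emeasure (bind_pmf (pmf_of_set S) Q) X"
    by (simp add: measure_pmf.emeasure_eq_measure)
  also have "\<dots> = (\<Sum>x\<in>S. emeasure (Q x) X) / card S"
    using assms by (simp add: nn_integral_pmf_of_set)
  also have "\<dots> = ennreal ((\<Sum>x\<in>S. measure_pmf.prob (Q x) X) / card S)"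
    using assms by (simp add: measure_pmf.emeasure_eq_measure ennreal_of_nat_eq_real_of_nat divide_ennreal card_gt_0_iff sum_nonneg)
  finally show ?thesis by (simp add: sum_nonneg)
qed

text \<open>The right-hand side is a supermartingale along the run: a step with \<open>k\<close>
  children increases the expected total weight by a factor of at most
  \<open>exp ((L - 1) * k / D)\<close>, which the shrinking number of unembedded vertices pays for.
  A failure needs more than \<theta> occupied neighbours at the current vertex, and then the
  potential is at least \<open>L powr \<theta>\<close>, so the estimate is Markov's inequality
  carried through the induction.\<close>

lemma embed_run_failure_bound:
  fixes L D \<theta> :: real and G :: "'b pair_pre_digraph"
  assumes T: "is_tree T" and G: "pair_graph G" "C4_free G" and r: "r \<in> pverts T"
    and L: "1 \<le> L" and D: "0 < D"
    and degT: "\<And>x. x \<in> pverts T \<Longrightarrow> real (out_degree T x) \<le> D"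
    and degG: "\<And>x. x \<in> pverts G \<Longrightarrow> D + \<theta> \<le> real (out_degree G x)"
    and run: "embed_run T G r f P" and f: "partial_embedding T G r f"
  shows "measure_pmf.prob P (- finds_embedding T G) * L powr \<theta> \<le>
    exp ((L - 1) / D * (real (card (pverts T)) - real (card (dom f)))) * total_weight L T G r f"
  using run f
proof induction
  case (finished f)
  then have "Some f \<in> finds_embedding T G"
    by (intro partial_embedding_finished[OF T G(1) r])
  then have "measure_pmf.prob (return_pmf (Some f)) (- finds_embedding T G) = 0"
    by (simp add: measure_return)
  then show ?case using total_weight_nonneg[OF L, of T G r f] by simp
next
  let ?m = "\<lambda>f :: 'a \<rightharpoonup> 'b. (L - 1) / D * (real (card (pverts T)) - real (card (dom f)))"
  interpret G: pair_graph G by fact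
  interpret T: pair_graph T using T by (simp add: is_tree_def)
  have m_nonneg: "0 \<le> ?m f" if "partial_embedding T G r f" for f
  proof -
    have "card (dom f) \<le> card (pverts T)"
      using that by (intro card_mono T.pair_finite_verts) (simp add: partial_embedding_def)
    then show ?thesis using L D by (intro mult_nonneg_nonneg divide_nonneg_pos) auto
  qed
  have crowded: "L powr \<theta> \<le> exp (?m f) * total_weight L T G r f"
    if f: "partial_embedding T G r f" and pend: "pending T r f u"
      and \<theta>: "\<theta> < real (occupied G f (the (f u)))" for f u
  proof -
    let ?v = "the (f u)"
    have u: "f u = Some ?v" using pend by (auto simp: pending_def)
    then have v: "?v \<in> pverts G" using f ranI[of f u] by (auto simp: partial_embedding_def)
    \<comment> \<open>By injectivity \<open>u\<close> is the only preimage of \<open>?v\<close>, and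
      its children are not embedded, so \<open>?v\<close> is still active and its weight
      counts.\<close>
    have "x = u" if "f x = Some ?v" for x
      using that u f unfolding partial_embedding_def by (metis domI inj_on_eq_iff)
    then have act: "?v \<in> active T r f" using pend by (auto simp: active_def pending_def)
    have "L powr \<theta> \<le> L powr real (max 2 (occupied G f ?v))"
      using \<theta> L by (intro powr_mono) auto
    also have "\<dots> = weight L T G r f ?v + L ^ 2"
      using L act by (simp add: weight_def powr_realpow del: of_nat_max)
    also have "\<dots> \<le> total_weight L T G r f"
    proof -
      have "weight L T G r f ?v \<le> (\<Sum>v\<in>pverts G. weight L T G r f v)"
        using v G.pair_finite_verts by (intro member_le_sum weight_nonneg L) auto
      moreover have "1 \<le> card (pverts T)"
        using r T.pair_finite_verts by (simp add: Suc_le_eq card_gt_0_iff) blast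
      then have "L ^ 2 * 1 \<le> L ^ 2 * real (card (pverts T)) ^ 2"
        by (intro mult_left_mono one_le_power) auto
      ultimately show ?thesis by (simp add: total_weight_def)
    qed
    also have "\<dots> \<le> exp (?m f) * total_weight L T G r f"
      using total_weight_nonneg[OF L, of T G r f] m_nonneg[OF f]
        mult_right_mono[of 1 "exp (?m f)" "total_weight L T G r f"] by simp
    finally show ?thesis .
  qed
  \<comment> \<open>Once a crowded vertex has been chosen, the rest of the run is not followed: its
    failure probability is estimated by 1.\<close>
  have bound: "measure_pmf.prob P X * L powr \<theta> \<le> L powr \<theta>" for P X
    using mult_right_mono[OF measure_pmf.prob_le_1, of "L powr \<theta>" P X] by simp
  have large: "D \<le> real (card (available G f u))"
    if f: "partial_embedding T G r f" and pend: "pending T r f u"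
      and \<theta>: "\<not> \<theta> < real (occupied G f (the (f u)))" for f u
  proof -
    let ?v = "the (f u)"
    have "f u = Some ?v" using pend by (auto simp: pending_def)
    then have v: "?v \<in> pverts G" using f ranI[of f u] by (auto simp: partial_embedding_def)
    have "card (available G f u) = card (neighbours G ?v) - occupied G f ?v"
      using finite_neighbours[OF G(1)] by (simp add: available_def occupied_def card_Diff_subset_Int)
    moreover have "real (occupied G f ?v) \<le> \<theta>" using \<theta> by simp
    ultimately show ?thesis using degG[OF v] by (simp add: card_neighbours)
  qed
  have few: "real (card (children T r u)) \<le> D"
    if f: "partial_embedding T G r f" and pend: "pending T r f u" for f u
  proof -
    have u: "u \<in> pverts T" using that by (auto simp: partial_embedding_def pending_def)
    have "card (children T r u) \<le> out_degree T u"
      using card_mono[OF finite_neighbours children_subset_neighbours] T.pair_graph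
      by (simp add: card_neighbours)
    then show ?thesis using degT[OF u] by simp
  qed
  {
    case (fail f u)
    \<comment> \<open>With at most \<theta> occupied neighbours there are at least \<open>D\<close>
      available ones, enough for the at most \<open>D\<close> children.\<close>
    have "\<theta> < real (occupied G f (the (f u)))"
    proof (rule ccontr)
      assume "\<not> ?thesis"
      then show False using large few fail by fastforce
    qed
    then show ?case using crowded fail bound order_trans by blast
  next
    case (step f u Q)
    show ?case
    proof (cases "\<theta> < real (occupied G f (the (f u)))")
      case True
      then show ?thesis using crowded step bound order_trans by blast
    next
      case False
      let ?S = "extensions T G r f u"
      let ?k = "real (card (children T r u))" and ?n = "real (card (available G f u))"
      have Dn: "D \<le> ?n" using large[OF step.prems step.hyps(2) False] .
      have S: "finite ?S" "?S \<noteq> {}"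
        using finite_extensions[OF T.pair_graph G(1)] step.hyps(3)
          extensions_nonempty[OF T.pair_graph G(1)] by auto
      then have card_S: "0 < real (card ?S)" by (simp add: card_gt_0_iff)
      \<comment> \<open>The step consumes exactly the part of the exponent that its growth factor
        will need.\<close>
      have dom: "?m g = ?m f - (L - 1) / D * ?k" if g: "g \<in> ?S" for g
      proof -
        have "dom g = dom f \<union> children T r u" "dom f \<inter> children T r u = {}"
          using extensionsE[OF step.hyps(2) g] by (metis dom_map_add sup_commute)+
        moreover have "finite (dom f)"
          using step.prems finite_subset[OF _ T.pair_finite_verts] by (auto simp: partial_embedding_def)
        ultimately have "card (dom g) = card (dom f) + card (children T r u)"
          by (simp add: card_Un_disjoint finite_children[OF T.pair_graph])
        then show ?thesis by (simp add: algebra_simps)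
      qed
      have "measure_pmf.prob (bind_pmf (pmf_of_set ?S) Q) (- finds_embedding T G) * L powr \<theta> =
          (\<Sum>g\<in>?S. measure_pmf.prob (Q g) (- finds_embedding T G) * L powr \<theta>) / card ?S"
        by (simp add: prob_bind_pmf_of_set[OF S] sum_distrib_right)
      also have "\<dots> \<le> (\<Sum>g\<in>?S. exp (?m g) * total_weight L T G r g) / card ?S"
        using step.IH partial_embedding_step[OF T G(1) step.prems step.hyps(2)]
        by (intro divide_right_mono sum_mono) auto
      also have "\<dots> = exp (?m f - (L - 1) / D * ?k) * ((\<Sum>g\<in>?S. total_weight L T G r g) / card ?S)"
        using dom by (simp add: sum_distrib_left[symmetric])
      also have "\<dots> \<le> exp (?m f - (L - 1) / D * ?k) *
          (exp ((L - 1) / D * ?k) * total_weight L T G r f)"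
      proof (intro mult_left_mono)
        have "0 < card (available G f u)" using Dn D by (cases "card (available G f u)") auto
        then have "(\<Sum>g\<in>?S. total_weight L T G r g) / card ?S \<le>
            (1 + (L - 1) * ?k / ?n) * total_weight L T G r f"
          using total_weight_step[OF T G L step.prems step.hyps(2)] card_S
          by (simp add: pos_divide_le_eq mult.commute)
        also have "\<dots> \<le> exp ((L - 1) / D * ?k) * total_weight L T G r f"
        proof (intro mult_right_mono total_weight_nonneg L)
          have "(L - 1) * ?k / ?n \<le> (L - 1) * ?k / D"
            using L Dn D by (intro divide_left_mono) auto
          then show "1 + (L - 1) * ?k / ?n \<le> exp ((L - 1) / D * ?k)"
            using exp_ge_add_one_self[of "(L - 1) / D * ?k"] unfolding times_divide_eq_left by linarith
        qed
        finally show "(\<Sum>g\<in>?S. total_weight L T G r g) / card ?S \<le>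
            exp ((L - 1) / D * ?k) * total_weight L T G r f" .
      qed simp
      also have "\<dots> = exp (?m f) * total_weight L T G r f"
        by (simp add: exp_add[symmetric] flip: mult.assoc)
      finally show ?thesis .
    qed
  }
qed

section \<open>The initial potential and the choice of constants\<close>

lemma total_weight_root:
  "total_weight L T G r [r \<mapsto> v] = L ^ 2 * real (card (pverts T)) ^ 2"
proof -
  \<comment> \<open>Only one vertex is occupied, so every weight is below the cutoff and only the
    additive constant remains.\<close>
  have "occupied G [r \<mapsto> v] x \<le> 1" for x
    using card_mono[of "{v}" "neighbours G x \<inter> {v}"] by (simp add: occupied_def)
  then have "max 2 (occupied G [r \<mapsto> v] x) = 2" for x
    by (metis max_absorb1 numeral_2_eq_2 le_Suc_eq One_nat_def)
  then have "weight L T G r [r \<mapsto> v] x = 0" for x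
    by (auto simp: weight_def)
  then show ?thesis by (simp add: total_weight_def)
qed

text \<open>
  The expected exponent is \<open>(L - 1) \<epsilon> d / (1 - 2 \<epsilon>)\<close> up to lower order terms; it stays below
  \<open>2 \<epsilon> d ln L\<close> because \<open>1 / (1 - 2 \<epsilon>) \<le> 4 / 3\<close> and \<open>L = exp (1 / 4)\<close> is close enough to 1.
\<close>

lemma algorithm1_failure_bound:
  fixes \<epsilon> :: real and d :: nat and G :: "'b pair_pre_digraph"
  assumes eps: "0 < \<epsilon>" "\<epsilon> \<le> 1 / 8" and d: "24 \<le> d"
    and T: "is_tree T" and G: "pair_graph G" "C4_free G"
    and r: "r \<in> pverts T" and v: "v \<in> pverts G"
    and degG: "\<And>x. x \<in> pverts G \<Longrightarrow> d \<le> out_degree G x"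
    and card_T: "real (card (pverts T)) \<le> \<epsilon> * real d ^ 2"
    and degT: "\<And>x. x \<in> pverts T \<Longrightarrow> real (out_degree T x) \<le> real d - 2 * \<epsilon> * real d - 2"
    and run: "algorithm1 T G r v P"
  shows "measure_pmf.prob P (- finds_embedding T G) \<le>
    \<epsilon> ^ 2 * real d ^ 4 * exp (- (\<epsilon> * real d / 32))"
proof -
  have pT: "pair_graph T" using T by (simp add: is_tree_def)
  define L :: real where "L = exp (1 / 4)"
  \<comment> \<open>\<open>D\<close> bounds the degrees in \<open>T\<close>, and \<theta> is chosen
    so that \<open>D + \<theta> = d\<close>, the minimum degree bound for \<open>G\<close>.\<close>
  define D where "D = real d - 2 * \<epsilon> * real d - 2"
  define \<theta> where "\<theta> = 2 * \<epsilon> * real d + 2"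
  let ?n = "real (card (pverts T))"
  have "\<epsilon> * real d \<le> 1 / 8 * real d" using eps by (intro mult_right_mono) auto
  \<comment> \<open>As \<epsilon> is at most 1/8, \<open>D\<close> is at least
    \<open>3/4 * d - 2\<close>; this reaches \<open>2/3 * d\<close> exactly when \<open>d\<close> is
    at least 24.\<close>
  then have D: "2 / 3 * real d \<le> D" using d unfolding D_def by linarith
  then have D0: "0 < D" using d by simp
  \<comment> \<open>From \<open>exp x \<le> 1 + x + x^2\<close> at \<open>x = 1/4\<close>.\<close>
  have L: "1 \<le> L" "L - 1 \<le> 5 / 16"
    using exp_bound[of "1 / 4"] by (auto simp: L_def power2_eq_square)
  interpret T: pair_graph T by (rule pT)
  have "pverts T \<noteq> {}" using r by blast
  then have "0 < card (pverts T)" using T.pair_finite_verts by (simp only: card_gt_0_iff simp_thms)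
  then have n1: "1 \<le> ?n" by linarith
  have "(L - 1) / D * (?n - 1) \<le> (5 / 16) / (2 / 3 * real d) * (\<epsilon> * real d ^ 2)"
    using L D d card_T n1 eps by (intro mult_mono frac_le) auto
  also have "\<dots> = 15 / 32 * (\<epsilon> * real d)" using d by (simp add: power2_eq_square)
  finally have expo: "(L - 1) / D * (?n - 1) \<le> 15 / 32 * (\<epsilon> * real d)" .
  \<comment> \<open>The summand 2 in \<theta> yields the factor \<open>L ^ 2\<close> that cancels
    the one in the initial potential. The remaining exponent 1/2 beats 15/32, leaving the decay rate
    1/32.\<close>
  have powr: "L powr \<theta> = L ^ 2 * exp (\<epsilon> * real d / 2)"
    by (simp add: L_def \<theta>_def powr_def exp_add[symmetric] exp_of_nat_mult[symmetric] field_simps)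
  have "embed_run T G r [r \<mapsto> v] P" using run by (simp add: algorithm1_def)
  from embed_run_failure_bound[OF T G r L(1) D0 _ _ this partial_embedding_root[OF pT r v], of \<theta>]
  have "measure_pmf.prob P (- finds_embedding T G) * L powr \<theta> \<le>
      exp ((L - 1) / D * (?n - 1)) * (L ^ 2 * ?n ^ 2)"
    using degT degG by (force simp: total_weight_root D_def \<theta>_def)
  also have "\<dots> \<le> exp (15 / 32 * (\<epsilon> * real d)) * (L ^ 2 * (\<epsilon> * real d ^ 2) ^ 2)"
    using expo card_T by (intro mult_mono mult_left_mono power_mono) auto
  also have "\<dots> = L powr \<theta> * (\<epsilon> ^ 2 * real d ^ 4 * exp (- (\<epsilon> * real d / 32)))"
  proof -
    have "exp (15 / 32 * (\<epsilon> * real d)) = exp (\<epsilon> * real d / 2) * exp (- (\<epsilon> * real d / 32))"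
      by (simp add: exp_add[symmetric])
    then show ?thesis by (simp add: powr power_mult_distrib power_mult[symmetric])
  qed
  finally show ?thesis using L(1) by (simp add: mult.commute)
qed

text \<open>The failure bound depends only on \<epsilon> and \<open>d\<close>, which gives the
  uniformity in \<open>G\<close>, \<open>T\<close>, the starting choices and the order of
  processing. It tends to 0 because the exponential decay beats \<open>d ^ 4\<close>.\<close>

theorem theorem2p1:
  fixes \<epsilon> :: real
  assumes "0 < \<epsilon>" and "\<epsilon> \<le> 1 / 8"
  shows "\<forall>\<eta>>0. \<forall>\<^sub>F d :: nat in sequentially.
    \<forall>(G :: 'b pair_pre_digraph) (T :: 'a pair_pre_digraph) r v P.
      pair_graph G \<longrightarrow> C4_free G \<longrightarrow> (\<forall>x\<in>pverts G. d \<le> out_degree G x) \<longrightarrow>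
      is_tree T \<longrightarrow> real (card (pverts T)) \<le> \<epsilon> * real d ^ 2 \<longrightarrow>
      (\<forall>x\<in>pverts T. real (out_degree T x) \<le> real d - 2 * \<epsilon> * real d - 2) \<longrightarrow>
      r \<in> pverts T \<longrightarrow> v \<in> pverts G \<longrightarrow> algorithm1 T G r v P \<longrightarrow>
      measure_pmf.prob P (finds_embedding T G) \<ge> 1 - \<eta>"
proof (intro allI impI)
  fix \<eta> :: real assume "0 < \<eta>"
  have "((\<lambda>d::nat. \<epsilon> ^ 2 * real d ^ 4 * exp (- (\<epsilon> * real d / 32))) \<longlongrightarrow> 0) sequentially"
    using assms(1) by real_asymp
  then have "\<forall>\<^sub>F d :: nat in sequentially. \<epsilon> ^ 2 * real d ^ 4 * exp (- (\<epsilon> * real d / 32)) < \<eta>"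
    using \<open>0 < \<eta>\<close> by (rule order_tendstoD)
  then show "\<forall>\<^sub>F d :: nat in sequentially.
    \<forall>(G :: 'b pair_pre_digraph) (T :: 'a pair_pre_digraph) r v P.
      pair_graph G \<longrightarrow> C4_free G \<longrightarrow> (\<forall>x\<in>pverts G. d \<le> out_degree G x) \<longrightarrow>
      is_tree T \<longrightarrow> real (card (pverts T)) \<le> \<epsilon> * real d ^ 2 \<longrightarrow>
      (\<forall>x\<in>pverts T. real (out_degree T x) \<le> real d - 2 * \<epsilon> * real d - 2) \<longrightarrow>
      r \<in> pverts T \<longrightarrow> v \<in> pverts G \<longrightarrow> algorithm1 T G r v P \<longrightarrow>
      measure_pmf.prob P (finds_embedding T G) \<ge> 1 - \<eta>"
    using eventually_ge_at_top[of 24]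
  proof eventually_elim
    case (elim d)
    show ?case
    proof (intro allI impI)
      fix G :: "'b pair_pre_digraph" and T :: "'a pair_pre_digraph" and r v P
      assume "pair_graph G" "C4_free G" "\<forall>x\<in>pverts G. d \<le> out_degree G x" "is_tree T"
        "real (card (pverts T)) \<le> \<epsilon> * real d ^ 2"
        "\<forall>x\<in>pverts T. real (out_degree T x) \<le> real d - 2 * \<epsilon> * real d - 2"
        "r \<in> pverts T" "v \<in> pverts G" "algorithm1 T G r v P"
      then have "measure_pmf.prob P (- finds_embedding T G) \<le>
          \<epsilon> ^ 2 * real d ^ 4 * exp (- (\<epsilon> * real d / 32))"
        by (intro algorithm1_failure_bound[OF assms elim(2)]) auto
      then show "measure_pmf.prob P (finds_embedding T G) \<ge> 1 - \<eta>"
        using elim(1) measure_pmf.prob_compl[of "finds_embedding T G" P]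
        by (simp add: Compl_eq_Diff_UNIV)
    qed
  qed
qed

end
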